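(* Suppose $\bar{\beta} < \frac{\sigma}{2}\left(\frac{\underline{\lambda}}{\bar{\lambda}}-\underline{\lambda}L\right)$. Let $\{x^k\}_{k\in\mathbb{N}}$ be a sequence generated from $x^0$ by the algorithm iBPG. Then: (i) $\sum_{k=0}^{\infty} D_h(x^{k+1},x^k) < \infty$ and $\lim_{k\rightarrow\infty}\|x^k-x^{k-1}\| = 0$. (ii) Any cluster point of $\{x^k\}_{k\in\mathbb{N}}$ is a critical point of $\Psi$. (iii) $\zeta := \lim_{k\rightarrow\infty}\Psi(x^k)$ exists and $\Psi\equiv\zeta$ on $\omega(x^0)$.
   Context: Setting. Let $f,g:\mathbb{R}^d\to(-\infty,+\infty]$, $\Psi:=f+g$, and $L>0$. Standing assumptions: (A-i) $h:\mathbb{R}^d\to(-\infty,+\infty]$ is a kernel generating distance associated with $S=\mathbb{R}^d$, i.e. $h$ is proper, lower semicontinuous and convex, $\text{dom}\,h\subset\overline{S}$, $\text{dom}\,\partial h=S$, and $h$ is $C^1$ on $\text{int}\,\text{dom}\,h = S=\mathbb{R}^d$. Its Bregman distance is $D_h(x,y):=h(x)-h(y)-\langle\nabla h(y),x-y\rangle$. (A-ii) $f$ is $C^1$, $\text{dom}\,h\subset\text{dom}\,f$, and $(f,h)$ is $L$-smooth adaptable on $S=\mathbb{R}^d$, i.e. $Lh-f$ and $Lh+f$ are convex on $S$. ($f$ and $g$ need not be convex.) (A-iii) $g$ is proper and lower semicontinuous. (A-iv) $\inf\{\Psi(u):u\in\mathbb{R}^d\}>-\infty$. (B) $\Psi$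 is supercoercive: $\lim_{\|u\|\to\infty}\Psi(u)/\|u\|=\infty$. (C) $h$ is $\sigma$-strongly convex on $\mathbb{R}^d$, $\sigma>0$. Algorithm iBPG. Given $x^0=x^{-1}\in\text{int}\,\text{dom}\,h$ and parameters $0<\lambda_k\le 1/L$, $0\le\beta_k<1$ for $k\in\mathbb{N}=\{0,1,2,\dots\}$, for $k=0,1,2,\dots$ choose $$x^{k+1}\in\arg\min_{x\in\mathbb{R}^d}\left\{\lambda_k g(x)+\left\langle x,\lambda_k\nabla f(x^k)-\beta_k(x^k-x^{k-1})\right\rangle+D_h(x,x^k)\right\}.$$ Notation. $\bar{\beta}:=\sup_{k\in\mathbb{N}}\beta_k$, $\bar{\lambda}:=\sup_{k\in\mathbb{N}}\lambda_k$, $\underline{\lambda}:=\inf_{k\in\mathbb{N}}\lambda_k$, and it is assumed throughout that $\underline{\lambda}>0$. $\omega(x^0)$ denotes the set of all limit (cluster) points of $\{x^k\}_{k\in\mathbb{N}}$, i.e. limits of convergent subsequences. Critical points. The Fréchet subdifferential $\hat\partial F(\bar x)$ of $F$ at $\bar x\in\text{dom}\,F$ is the set of $v$ with $\liminf_{x\to\bar x,\,x\ne\bar x}\frac{F(x)-F(\bar x)-\langle v,x-\bar x\rangle}{\|x-\bar x\|}\ge 0$. The limiting subdifferential $\partial F(\bar x)$ at $\bar x\in\text{dom}\,F$ is the set of $v$ for which there exist $x^n\to\bar x$ with $F(x^n)\to F(\bar x)$ and $v^n\in\hat\partial F(x^n)$ with $v^n\to v$. Both are empty for $\bar x\notin\text{dom}\,F$.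 A critical point of $\Psi$ is a point $x$ with $0\in\partial\Psi(x)$, equivalently $0\in\nabla f(x)+\partial g(x)$. *)

theory Defs
  imports "HOL-Analysis.Analysis"
begin

(* Functions with values in (-\<infinity>, +\<infinity>] are functions into ereal; the value -\<infinity> is
   excluded by proper_fun, or by C1_on, which forces finite values. *)

definition dom_fun :: "('a \<Rightarrow> ereal) \<Rightarrow> 'a set"
  where "dom_fun F = {x. F x < \<infinity>}"

definition proper_fun :: "('a \<Rightarrow> ereal) \<Rightarrow> bool"
  where "proper_fun F \<longleftrightarrow> dom_fun F \<noteq> {} \<and> (\<forall>x. F x > -\<infinity>)"

definition lsc_fun :: "('a::topological_space \<Rightarrow> ereal) \<Rightarrow> bool"
  where "lsc_fun F \<longleftrightarrow> (\<forall>x. F x \<le> Liminf (at x) F)"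

(* Only used for functions that do not take the value -\<infinity>; restricting to 0 < t < 1 keeps
   both coefficients positive, so the products 0 * \<infinity> never occur. *)
definition econvex_on :: "'a::real_vector set \<Rightarrow> ('a \<Rightarrow> ereal) \<Rightarrow> bool"
  where "econvex_on S F \<longleftrightarrow> convex S \<and>
    (\<forall>x\<in>S. \<forall>y\<in>S. \<forall>t\<in>{0<..<1}.
       F ((1 - t) *\<^sub>R x + t *\<^sub>R y) \<le> ereal (1 - t) * F x + ereal t * F y)"

definition strongly_econvex_on :: "real \<Rightarrow> 'a::real_normed_vector set \<Rightarrow> ('a \<Rightarrow> ereal) \<Rightarrow> bool"
  where "strongly_econvex_on \<sigma> S F \<longleftrightarrow> convex S \<and>
    (\<forall>x\<in>S. \<forall>y\<in>S. \<forall>t\<in>{0<..<1}.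
       F ((1 - t) *\<^sub>R x + t *\<^sub>R y) + ereal (\<sigma> / 2 * t * (1 - t) * (norm (x - y))\<^sup>2)
         \<le> ereal (1 - t) * F x + ereal t * F y)"

(* Only meaningful at points near which F is finite and at which F is differentiable. *)
definition grad :: "('a::real_inner \<Rightarrow> ereal) \<Rightarrow> 'a \<Rightarrow> 'a"
  where "grad F x = (THE D. GDERIV (\<lambda>y. real_of_ereal (F y)) x :> D)"

(* Used for open S only. *)
definition C1_on :: "'a::real_inner set \<Rightarrow> ('a \<Rightarrow> ereal) \<Rightarrow> bool"
  where "C1_on S F \<longleftrightarrow>
    (\<forall>x\<in>S. \<bar>F x\<bar> \<noteq> \<infinity>) \<and>
    (\<forall>x\<in>S. \<exists>D. GDERIV (\<lambda>y. real_of_ereal (F y)) x :> D) \<and>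
    continuous_on S (grad F)"

definition frechet_subdiff :: "('a::real_inner \<Rightarrow> ereal) \<Rightarrow> 'a \<Rightarrow> 'a set"
  where "frechet_subdiff F xbar =
    {v. xbar \<in> dom_fun F \<and>
        0 \<le> Liminf (at xbar)
              (\<lambda>x. (F x - F xbar - ereal (v \<bullet> (x - xbar))) / ereal (norm (x - xbar)))}"

definition limiting_subdiff :: "('a::real_inner \<Rightarrow> ereal) \<Rightarrow> 'a \<Rightarrow> 'a set"
  where "limiting_subdiff F xbar =
    {v. xbar \<in> dom_fun F \<and>
        (\<exists>xs vs. xs \<longlonglongrightarrow> xbar \<and> (\<lambda>n. F (xs n)) \<longlonglongrightarrow> F xbar \<and>
                 (\<forall>n. vs n \<in> frechet_subdiff F (xs n)) \<and> vs \<longlonglongrightarrow> v)}"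

definition critical_point :: "('a::real_inner \<Rightarrow> ereal) \<Rightarrow> 'a \<Rightarrow> bool"
  where "critical_point F x \<longleftrightarrow> 0 \<in> limiting_subdiff F x"

(* For the convex function h the limiting subdifferential is the subdifferential of convex
   analysis, so the condition on limiting_subdiff is the usual dom \<partial>h = S. *)
definition kernel_generating_distance :: "'a::real_inner set \<Rightarrow> ('a \<Rightarrow> ereal) \<Rightarrow> bool"
  where "kernel_generating_distance S h \<longleftrightarrow>
    proper_fun h \<and> lsc_fun h \<and> econvex_on UNIV h \<and>
    dom_fun h \<subseteq> closure S \<and>
    {x. limiting_subdiff h x \<noteq> {}} = S \<and>
    interior (dom_fun h) = S \<and> C1_on S h"

definition bregman :: "('a::real_inner \<Rightarrow> ereal) \<Rightarrow> 'a \<Rightarrow> 'a \<Rightarrow> ereal"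
  where "bregman h x y = h x - h y - ereal (grad h y \<bullet> (x - y))"

definition smooth_adaptable :: "real \<Rightarrow> 'a::real_vector set \<Rightarrow> ('a \<Rightarrow> ereal) \<Rightarrow> ('a \<Rightarrow> ereal) \<Rightarrow> bool"
  where "smooth_adaptable L S f h \<longleftrightarrow>
    econvex_on S (\<lambda>x. ereal L * h x - f x) \<and> econvex_on S (\<lambda>x. ereal L * h x + f x)"

(* At k = 0 the truncated subtraction gives x (k - 1) = x 0, which is the convention
   that the iterate with index -1 equals the iterate with index 0. *)
definition iBPG :: "('a::real_inner \<Rightarrow> ereal) \<Rightarrow> ('a \<Rightarrow> ereal) \<Rightarrow> ('a \<Rightarrow> ereal) \<Rightarrow>
    (nat \<Rightarrow> real) \<Rightarrow> (nat \<Rightarrow> real) \<Rightarrow> (nat \<Rightarrow> 'a) \<Rightarrow> bool"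
  where "iBPG f g h lam \<beta> x \<longleftrightarrow>
    x 0 \<in> interior (dom_fun h) \<and>
    (\<forall>k. is_arg_min
       (\<lambda>u. ereal (lam k) * g u
            + ereal (u \<bullet> (lam k *\<^sub>R grad f (x k) - \<beta> k *\<^sub>R (x k - x (k - 1))))
            + bregman h u (x k))
       (\<lambda>u. True) (x (Suc k)))"

definition cluster_points :: "(nat \<Rightarrow> 'a::topological_space) \<Rightarrow> 'a set"
  where "cluster_points x = {u. \<exists>r. strict_mono r \<and> (x \<circ> r) \<longlonglongrightarrow> u}"

end

theory Submission
  imports Defs
begin

text \<open>
  Put \<open>b = sup \<beta> / inf \<lambda>\<close>, \<open>c = 1 / sup \<lambda> - L\<close> and \<open>d\<^sub>k = \<parallel>x\<^sup>k\<^sup>+\<^sup>1 - x\<^sup>k\<parallel>\<close>. Comparing the minimizer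
  \<open>x\<^sup>k\<^sup>+\<^sup>1\<close> of the subproblem with \<open>x\<^sup>k\<close> and using the descent lemma for the pair \<open>(f, h)\<close> gives
  \<open>\<Psi>(x\<^sup>k\<^sup>+\<^sup>1) + c D\<^sub>h(x\<^sup>k\<^sup>+\<^sup>1, x\<^sup>k) \<le> \<Psi>(x\<^sup>k) + (b/2) (d\<^sub>k\<^sub>-\<^sub>1\<^sup>2 + d\<^sub>k\<^sup>2)\<close>. By strong convexity \<open>d\<^sub>k\<^sup>2\<close> is at most
  \<open>(2/\<sigma>) D\<^sub>h(x\<^sup>k\<^sup>+\<^sup>1, x\<^sup>k)\<close>, and \<open>c > 2b/\<sigma>\<close>, so \<open>\<Psi>(x\<^sup>k) + (b/2) d\<^sub>k\<^sub>-\<^sub>1\<^sup>2\<close> is a Lyapunov function whose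
  decrease controls \<open>D\<^sub>h\<close>. At a cluster point \<open>u\<close>, comparing the minimizer with \<open>u\<close> bounds the limit of
  \<open>g(x\<^sup>k)\<close> from above by \<open>g(u)\<close>, lower semicontinuity gives the other bound, and the optimality
  condition of the subproblem yields Frechet subgradients of \<open>\<Psi>\<close> at \<open>x\<^sup>k\<^sup>+\<^sup>1\<close> tending to \<open>0\<close>.
\<close>

text \<open>Moves the calculus to real-valued functions. As \<open>grad\<close> is a definite
  description, uniqueness of the derivative is what makes it a gradient of \<open>F\<close>.\<close>

lemma C1_on_UNIV_cases:
  fixes f :: "'a::real_inner \<Rightarrow> ereal"
  assumes "C1_on UNIV f"
  obtains F where "f = (\<lambda>x. ereal (F x))" "\<And>x. GDERIV F x :> grad f x"
    "continuous_on UNIV (grad f)" "continuous_on UNIV F"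
proof -
  define F where "F = (\<lambda>x. real_of_ereal (f x))"
  have 1: "f = (\<lambda>x. ereal (F x))"
    using assms by (auto simp: C1_on_def F_def ereal_real)
  have 2: "GDERIV F x :> grad f x" for x
  proof -
    obtain D where D: "GDERIV F x :> D"
      using assms by (auto simp: C1_on_def F_def)
    have "D' = D" if "GDERIV F x :> D'" for D'
      using has_derivative_unique[OF that[unfolded gderiv_def] D[unfolded gderiv_def]]
      by (metis vector_eq_ldot)
    then have "grad f x = D"
      unfolding grad_def F_def[symmetric] using D by blast
    with D show ?thesis by simp
  qed
  have 3: "continuous_on UNIV F"
    using 2 by (auto simp: gderiv_def intro!: continuous_at_imp_continuous_on has_derivative_continuous)
  from that[OF 1 2 _ 3] assms show thesis by (simp add: C1_on_def)
qed

text \<open>Strong convexity along the segment from \<open>x\<close> to \<open>y\<close> bounds the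
  difference quotient at \<open>x\<close>; let t tend to 0 from the right. With \<sigma> > 0 this
  bounds the Bregman distance below, with \<sigma> = 0 it yields the descent lemma.\<close>

lemma strongly_econvex_on_gradient_ineq:
  fixes \<phi> :: "'a::real_inner \<Rightarrow> real"
  assumes conv: "strongly_econvex_on \<sigma> UNIV (\<lambda>x. ereal (\<phi> x))"
    and deriv: "GDERIV \<phi> x :> D"
  shows "\<phi> x + D \<bullet> (y - x) + \<sigma> / 2 * (norm (y - x))\<^sup>2 \<le> \<phi> y"
proof -
  have "((\<lambda>t. \<phi> (x + t *\<^sub>R (y - x))) has_derivative (\<lambda>t. (t *\<^sub>R (y - x)) \<bullet> D)) (at 0)"
    by (rule has_derivative_compose[of "\<lambda>t. x + t *\<^sub>R (y - x)" "\<lambda>t. t *\<^sub>R (y - x)" 0 UNIV])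
       (use deriv in \<open>auto simp: gderiv_def intro!: derivative_eq_intros\<close>)
  then have "((\<lambda>t. \<phi> (x + t *\<^sub>R (y - x))) has_real_derivative D \<bullet> (y - x)) (at 0)"
    by (simp add: has_field_derivative_def inner_commute mult_commute_abs)
  then have lim: "((\<lambda>t. (\<phi> (x + t *\<^sub>R (y - x)) - \<phi> x) / t) \<longlongrightarrow> D \<bullet> (y - x)) (at_right 0)"
    unfolding has_field_derivative_iff by (auto intro: tendsto_mono[OF at_within_le_at])
  have lim2: "((\<lambda>t. \<phi> y - \<phi> x - \<sigma> / 2 * (1 - t) * (norm (y - x))\<^sup>2) \<longlongrightarrow>
      \<phi> y - \<phi> x - \<sigma> / 2 * (1 - 0) * (norm (y - x))\<^sup>2) (at_right 0)"
    by (intro tendsto_intros)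
  have "\<forall>\<^sub>F t in at_right 0. (\<phi> (x + t *\<^sub>R (y - x)) - \<phi> x) / t
      \<le> \<phi> y - \<phi> x - \<sigma> / 2 * (1 - t) * (norm (y - x))\<^sup>2"
    unfolding eventually_at_right_field
  proof (intro exI[of _ 1] conjI allI impI)
    fix t :: real assume t: "0 < t" "t < 1"
    have "ereal (\<phi> ((1 - t) *\<^sub>R x + t *\<^sub>R y)) + ereal (\<sigma> / 2 * t * (1 - t) * (norm (x - y))\<^sup>2)
         \<le> ereal (1 - t) * ereal (\<phi> x) + ereal t * ereal (\<phi> y)"
      using conv t unfolding strongly_econvex_on_def by auto
    moreover have "(1 - t) *\<^sub>R x + t *\<^sub>R y = x + t *\<^sub>R (y - x)"
      by (simp add: algebra_simps)
    ultimately have "\<phi> (x + t *\<^sub>R (y - x)) - \<phi> x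
        \<le> t * (\<phi> y - \<phi> x - \<sigma> / 2 * (1 - t) * (norm (y - x))\<^sup>2)"
      by (simp add: norm_minus_commute algebra_simps)
    then show "(\<phi> (x + t *\<^sub>R (y - x)) - \<phi> x) / t
        \<le> \<phi> y - \<phi> x - \<sigma> / 2 * (1 - t) * (norm (y - x))\<^sup>2"
      using t by (simp add: pos_divide_le_eq mult.commute)
  qed simp
  from tendsto_le[OF _ lim2 lim this] show ?thesis by simp
qed

lemma strongly_econvex_on_zero: "strongly_econvex_on 0 S F = econvex_on S F"
  by (simp add: strongly_econvex_on_def econvex_on_def)

text \<open>The difference quotient of \<open>F\<close> dominates that of a differentiable minorant
  touching it at \<open>y\<close>, and the latter tends to 0. This avoids any sum rule for
  subdifferentials.\<close>

lemma frechet_subdiffI: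
  fixes F :: "'a::real_inner \<Rightarrow> ereal"
  assumes y: "F y = ereal (\<phi> y)"
    and minor: "\<And>u. ereal (\<phi> u) \<le> F u"
    and deriv: "GDERIV \<phi> y :> v"
  shows "v \<in> frechet_subdiff F y"
proof -
  let ?q = "\<lambda>u. (\<phi> u - \<phi> y - v \<bullet> (u - y)) / norm (u - y)"
  have "(?q \<longlongrightarrow> 0) (at y)"
    using deriv unfolding gderiv_def has_derivative_at_within
    by (simp add: inner_commute divide_inverse mult.commute)
  then have lim: "((\<lambda>u. ereal (?q u)) \<longlongrightarrow> ereal 0) (at y)"
    by simp
  have "\<forall>\<^sub>F u in at y. ereal (?q u) \<le>
      (F u - F y - ereal (v \<bullet> (u - y))) / ereal (norm (u - y))"
  proof (rule eventually_at_topological[THEN iffD2, OF exI[of _ UNIV]], safe)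
    fix u assume "u \<noteq> y"
    then show "ereal (?q u) \<le> (F u - F y - ereal (v \<bullet> (u - y))) / ereal (norm (u - y))"
      using minor[of u] y by (cases "F u") (auto simp: divide_right_mono)
  qed auto
  then have "Liminf (at y) (\<lambda>u. ereal (?q u)) \<le>
     Liminf (at y) (\<lambda>u. (F u - F y - ereal (v \<bullet> (u - y))) / ereal (norm (u - y)))"
    by (rule Liminf_mono)
  moreover have "0 \<le> Liminf (at y) (\<lambda>u. ereal (?q u))"
  proof (cases "at y = bot")
    \<comment> \<open>In the zero space \<open>at y\<close> is trivial and the Liminf is
      \<infinity>.\<close>
    case True then show ?thesis by simp
  next
    case False
    then show ?thesis using lim_imp_Liminf[OF False lim] by simp
  qed
  ultimately show ?thesis
    unfolding frechet_subdiff_def using y by (auto simp: dom_fun_def)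
qed

lemma lsc_fun_le_lim:
  fixes F :: "'a::topological_space \<Rightarrow> ereal" and X :: "nat \<Rightarrow> 'a"
  assumes lsc: "lsc_fun F" and X: "X \<longlonglongrightarrow> u"
    and le: "\<And>n. F (X n) \<le> c n" and c: "c \<longlonglongrightarrow> C"
  shows "F u \<le> C"
proof (rule ccontr)
  assume "\<not> F u \<le> C"
  then obtain y where y: "C < y" "y < F u"
    using dense[of C "F u"] by (auto simp: not_le)
  have "\<forall>\<^sub>F z in at u. y < F z"
    using lsc y(2) unfolding lsc_fun_def le_Liminf_iff by blast
  \<comment> \<open>The value at \<open>u\<close> itself also exceeds \<open>y\<close>; this matters
    because \<open>X n\<close> may equal \<open>u\<close>.\<close>
  then have "\<forall>\<^sub>F z in nhds u. y < F z"
    using y(2) by (auto simp: eventually_at_filter elim: eventually_mono)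
  then have "\<forall>\<^sub>F n in sequentially. y < F (X n)"
    using X by (auto simp: filterlim_iff)
  moreover have "\<forall>\<^sub>F n in sequentially. c n < y"
    using c y(1) by (rule order_tendstoD)
  ultimately have "\<forall>\<^sub>F n in sequentially. y < F (X n) \<and> c n < y"
    by (rule eventually_conj)
  then obtain n where "y < F (X n)" "c n < y"
    by (auto dest: eventually_happens)
  with le[of n] show False by simp
qed

text \<open>Comparison with a point of the domain makes \<open>g y\<close> finite. Dividing the
  optimality inequality by \<open>lam\<close> then gives a minorant of \<open>g\<close> that touches
  it at the minimizer, the form needed for subgradients.\<close>

lemma proper_arg_min_cases:
  fixes \<phi> :: "'a \<Rightarrow> real"
  assumes g: "proper_fun g" and lam: "0 < lam"
    and arg: "is_arg_min (\<lambda>u. ereal lam * g u + ereal (\<phi> u)) (\<lambda>u. True) y"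
  obtains \<gamma> where "g y = ereal \<gamma>" "\<And>u. ereal (\<gamma> + (\<phi> y - \<phi> u) / lam) \<le> g u"
proof -
  have le: "ereal lam * g y + ereal (\<phi> y) \<le> ereal lam * g u + ereal (\<phi> u)" for u
    using arg by (auto simp: is_arg_min_def not_less)
  have ninf: "g u \<noteq> -\<infinity>" for u using g by (auto simp: proper_fun_def)
  obtain z where "g z < \<infinity>" using g by (auto simp: proper_fun_def dom_fun_def)
  then have "g y \<noteq> \<infinity>"
    using le[of z] lam ninf[of z] by (cases "g z") auto
  with ninf obtain \<gamma> where \<gamma>: "g y = ereal \<gamma>" by (cases "g y") auto
  have "ereal (\<gamma> + (\<phi> y - \<phi> u) / lam) \<le> g u" for u
    using le[of u] \<gamma> lam ninf[of u] by (cases "g u") (auto simp: field_simps)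
  with \<gamma> that show thesis by blast
qed

lemma inertial_descent_converges:
  fixes P d D :: "nat \<Rightarrow> real"
  assumes descent: "\<And>k. P (Suc k) + c * D k \<le> P k + b / 2 * ((d k)\<^sup>2 + (d (Suc k))\<^sup>2)"
    and strong: "\<And>k. \<sigma> / 2 * (d (Suc k))\<^sup>2 \<le> D k"
    and bdd: "\<And>k. m \<le> P k"
    and \<sigma>: "0 < \<sigma>" and b: "0 \<le> b" "b < \<sigma> / 2 * c"
  shows "summable D" "d \<longlonglongrightarrow> 0" "convergent P"
proof -
  define E where "E k = P k + b / 2 * (d k)\<^sup>2" for k
  \<comment> \<open>Forming \<open>E (Suc k)\<close> adds a second copy of
    \<open>b / 2 * (d (Suc k))\<^sup>2\<close>. The two copies together cost at most
    \<open>2 * b / \<sigma> * D k\<close>, to be paid out of \<open>c * D k\<close>.\<close>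
  define e where "e = c - 2 * b / \<sigma>"
  have e: "0 < e" using \<sigma> b by (simp add: e_def field_simps)
  have D0: "0 \<le> D k" for k using strong[of k] \<sigma> by (smt (verit) divide_pos_pos mult_nonneg_nonneg zero_le_power2)
  have step: "E (Suc k) + e * D k \<le> E k" for k
  proof -
    have "b * (d (Suc k))\<^sup>2 \<le> 2 * b / \<sigma> * D k"
      using mult_left_mono[OF strong[of k], of "2 * b / \<sigma>"] \<sigma> b by simp
    with descent[of k] show ?thesis
      by (simp add: E_def e_def algebra_simps)
  qed
  have E_ge: "m \<le> E k" for k using bdd[of k] b by (simp add: E_def add_increasing2)
  have dec: "decseq E"
    using step e D0 by (intro decseq_SucI) (smt (verit) mult_nonneg_nonneg)
  have "e * (\<Sum>i<n. D i) \<le> E 0 - E n" for n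
  proof (induction n)
    case (Suc n)
    then show ?case using step[of n] by (simp add: distrib_left)
  qed simp
  then have "(\<Sum>i<n. D i) \<le> (E 0 - m) / e" for n
    using E_ge[of n] e by (simp add: field_simps) (smt (verit))
  with D0 show D: "summable D" by (rule summableI_nonneg_bounded)
  have "(\<lambda>k. (d (Suc k))\<^sup>2) \<longlonglongrightarrow> 0"
  proof (rule tendsto_sandwich[OF _ _ tendsto_const])
    show "(\<lambda>k. 2 / \<sigma> * D k) \<longlonglongrightarrow> 0"
      using tendsto_mult_right_zero[OF summable_LIMSEQ_zero[OF D]] by blast
    show "\<forall>\<^sub>F k in sequentially. (d (Suc k))\<^sup>2 \<le> 2 / \<sigma> * D k"
      using strong \<sigma> by (auto simp: field_simps)
  qed simp
  then have "(\<lambda>k. (d k)\<^sup>2) \<longlonglongrightarrow> 0" by (rule LIMSEQ_imp_Suc)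
  then have d2: "(\<lambda>k. b / 2 * (d k)\<^sup>2) \<longlonglongrightarrow> 0" and d: "d \<longlonglongrightarrow> 0"
    by (auto intro: tendsto_mult_right_zero simp: tendsto_null_power)
  show "d \<longlonglongrightarrow> 0" by (rule d)
  obtain l where "E \<longlonglongrightarrow> l" using decseq_convergent[OF dec] E_ge by blast
  then have "(\<lambda>k. E k - b / 2 * (d k)\<^sup>2) \<longlonglongrightarrow> l - 0" by (intro tendsto_diff d2)
  then show "convergent P" by (auto simp: E_def convergent_def)
qed

text \<open>Needed because step sizes and inertial weights are bounded but need not
  converge.\<close>

lemma bounded_scaleR_tendsto_zero:
  fixes z :: "nat \<Rightarrow> 'a::real_normed_vector"
  assumes "z \<longlonglongrightarrow> 0" "\<And>n. \<bar>c n\<bar> \<le> K"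
  shows "(\<lambda>n. c n *\<^sub>R z n) \<longlonglongrightarrow> 0"
  by (rule tendsto_0_le[OF assms(1), of _ K])
     (simp add: mult.commute[of _ K] mult_right_mono assms(2))

theorem lemma3:
  fixes f g h \<Psi> :: "'a::euclidean_space \<Rightarrow> ereal"
    and L \<sigma> :: real
    and lam \<beta> :: "nat \<Rightarrow> real"
    and x :: "nat \<Rightarrow> 'a"
  assumes Psi: "\<Psi> = (\<lambda>u. f u + g u)"
    and L: "L > 0"
    and h_kernel: "kernel_generating_distance UNIV h"
    and f_C1: "C1_on UNIV f"
    and dom_hf: "dom_fun h \<subseteq> dom_fun f"
    and smad: "smooth_adaptable L UNIV f h"
    and g_proper: "proper_fun g"
    and g_lsc: "lsc_fun g"
    and Psi_bdd: "(INF u. \<Psi> u) > -\<infinity>"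
    and Psi_supercoercive: "((\<lambda>u. \<Psi> u / ereal (norm u)) \<longlongrightarrow> \<infinity>) at_infinity"
    and sigma: "\<sigma> > 0"
    and h_strong: "strongly_econvex_on \<sigma> UNIV h"
    and lam_range: "\<And>k. 0 < lam k \<and> lam k \<le> 1 / L"
    and beta_range: "\<And>k. 0 \<le> \<beta> k \<and> \<beta> k < 1"
    and lam_inf: "(INF k. lam k) > 0"
    and beta_small: "(SUP k. \<beta> k) <
          \<sigma> / 2 * ((INF k. lam k) / (SUP k. lam k) - (INF k. lam k) * L)"
    and gen: "iBPG f g h lam \<beta> x"
  shows "((\<Sum>k. bregman h (x (Suc k)) (x k)) < \<infinity> \<and>
          (\<lambda>k. norm (x k - x (k - 1))) \<longlonglongrightarrow> 0) \<and>
         (\<forall>u \<in> cluster_points x. critical_point \<Psi> u) \<and>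
         (\<exists>\<zeta>::real. (\<lambda>k. \<Psi> (x k)) \<longlonglongrightarrow> ereal \<zeta> \<and>
            (\<forall>u \<in> cluster_points x. \<Psi> u = ereal \<zeta>))"
proof -

  \<comment> \<open>Real-valued representatives and Bregman inequalities\<close>
  obtain F where f: "f = (\<lambda>u. ereal (F u))" and F': "\<And>u. GDERIV F u :> grad f u"
    and cont_f': "continuous_on UNIV (grad f)" and cont_F: "continuous_on UNIV F"
    using C1_on_UNIV_cases[OF f_C1] by blast
  obtain H where h: "h = (\<lambda>u. ereal (H u))" and H': "\<And>u. GDERIV H u :> grad h u"
    and cont_h': "continuous_on UNIV (grad h)" and cont_H: "continuous_on UNIV H"
    using C1_on_UNIV_cases[of h] h_kernel unfolding kernel_generating_distance_def by blast
  define D where "D u v = H u - H v - grad h v \<bullet> (u - v)" for u v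
  have breg: "bregman h u v = ereal (D u v)" for u v
    unfolding bregman_def D_def by (subst (1 2) h) simp
  have D_strong: "\<sigma> / 2 * (norm (u - v))\<^sup>2 \<le> D u v" for u v
    using strongly_econvex_on_gradient_ineq[OF h_strong[unfolded h] H'[of v, unfolded h], of u]
    by (simp add: D_def h)
  have D_nonneg: "0 \<le> D u v" for u v
    using D_strong[of u v] sigma by (smt (verit) divide_pos_pos mult_nonneg_nonneg zero_le_power2)
  have descent_lemma: "F u - F v - grad f v \<bullet> (u - v) \<le> L * D u v" for u v
  proof -
    \<comment> \<open>The gradient inequality for the convex function \<open>L * H - F\<close>,
      rearranged, is the claim.\<close>
    have "strongly_econvex_on 0 UNIV (\<lambda>u. ereal (L * H u - F u))"
      using smad unfolding smooth_adaptable_def strongly_econvex_on_zero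
      by (subst (asm) (1 2) f, subst (asm) (1 2) h) simp
    moreover have "GDERIV (\<lambda>u. L * H u - F u) v :> L *\<^sub>R grad h v - grad f v"
      using F'[of v] H'[of v] unfolding gderiv_def
      by (auto intro!: derivative_eq_intros simp: inner_diff_right)
    ultimately show ?thesis
      using strongly_econvex_on_gradient_ineq[of 0 "\<lambda>u. L * H u - F u" v _ u]
      by (fastforce simp: D_def algebra_simps)
  qed

  \<comment> \<open>Constants from the parameter bounds\<close>
  define li ls bs where "li = (INF k. lam k)" and "ls = (SUP k. lam k)" and "bs = (SUP k. \<beta> k)"
  have "bdd_below (range lam)" "bdd_above (range lam)" "bdd_above (range \<beta>)"
    using lam_range beta_range by (meson bdd_belowI2 bdd_aboveI2 less_imp_le)+
  then have li: "li \<le> lam k" and ls: "lam k \<le> ls" and bs: "\<beta> k \<le> bs" for k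
    by (auto simp: li_def ls_def bs_def intro: cINF_lower cSUP_upper)
  have li_pos: "0 < li" using lam_inf by (simp add: li_def)
  have ls_pos: "0 < ls" using li_pos li[of 0] ls[of 0] by linarith
  have bs_nonneg: "0 \<le> bs" using bs[of 0] beta_range[of 0] by linarith
  define b c where "b = bs / li" and "c = 1 / ls - L"
  have b: "0 \<le> b" "b < \<sigma> / 2 * c"
  proof -
    show "0 \<le> b" using bs_nonneg li_pos by (simp add: b_def)
    \<comment> \<open>This is \<open>beta_small\<close> with \<open>li\<close> factored out.\<close>
    have "bs < li * (\<sigma> / 2 * c)"
      using beta_small unfolding li_def[symmetric] ls_def[symmetric] bs_def[symmetric]
      by (simp add: c_def algebra_simps)
    then show "b < \<sigma> / 2 * c"
      using li_pos by (simp add: b_def pos_divide_less_eq mult.commute)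
  qed
  have beta_lam: "\<beta> k / lam k \<le> b" for k
    unfolding b_def using bs[of k] li[of k] li_pos bs_nonneg beta_range[of k] by (intro frac_le) auto
  have inv_lam: "1 / ls \<le> 1 / lam k" "1 / lam k \<le> 1 / li" for k
    using li[of k] ls[of k] li_pos lam_range[of k] by (auto intro: frac_le)

  \<comment> \<open>Optimality of the subproblem\<close>
  define w where "w k = lam k *\<^sub>R grad f (x k) - \<beta> k *\<^sub>R (x k - x (k - 1))" for k
  \<comment> \<open>The finite part of the subproblem objective, which is
    \<open>lam k * g + \<phi> k\<close>.\<close>
  define \<phi> where "\<phi> k u = u \<bullet> w k + D u (x k)" for k u
  have "is_arg_min (\<lambda>u. ereal (lam k) * g u + ereal (\<phi> k u)) (\<lambda>u. True) (x (Suc k))" for k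
    using gen unfolding iBPG_def breg \<phi>_def w_def by (simp add: add.assoc)
  then have "\<exists>\<gamma>. g (x (Suc k)) = ereal \<gamma> \<and>
      (\<forall>u. ereal (\<gamma> + (\<phi> k (x (Suc k)) - \<phi> k u) / lam k) \<le> g u)" for k
    using proper_arg_min_cases[OF g_proper] lam_range[of k] by metis
  then obtain G where G: "\<And>k. g (x (Suc k)) = ereal (G k)"
    and step: "\<And>k u. ereal (G k + (\<phi> k (x (Suc k)) - \<phi> k u) / lam k) \<le> g u"
    by metis
  txt \<open>The sequence starts at \<open>x\<^sup>1\<close> because \<open>g\<close> may be infinite at \<open>x\<^sup>0\<close>.\<close>
  define P where "P k = F (x (Suc k)) + G k" for k
  have Psi_P: "\<Psi> (x (Suc k)) = ereal (P k)" for k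
    by (simp add: Psi P_def G) (simp add: f)
  have INF_le: "(INF u. \<Psi> u) \<le> \<Psi> u" for u by (rule INF_lower) simp
  obtain m where m: "\<And>k. m \<le> P k"
  \<comment> \<open>The infimum is real: it is not -\<infinity> by assumption, and not \<infinity>
    since \<Psi> is finite at \<open>x 1\<close>.\<close>
  proof (cases "INF u. \<Psi> u")
    case (real m)
    with INF_le[of "x (Suc _)"] show thesis by (intro that) (simp add: Psi_P)
  qed (use Psi_bdd INF_le[of "x (Suc 0)"] in \<open>auto simp: Psi_P\<close>)

  \<comment> \<open>Descent, summability and convergence of the values\<close>
  define d where "d k = norm (x (Suc k) - x k)" for k
  have descent: "P (Suc k) + c * D (x (Suc (Suc k))) (x (Suc k))
      \<le> P k + b / 2 * ((d k)\<^sup>2 + (d (Suc k))\<^sup>2)" for k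
  proof -
    let ?y = "x (Suc (Suc k))" and ?z = "x (Suc k)" and ?l = "lam (Suc k)" and ?\<beta> = "\<beta> (Suc k)"
    let ?I = "(?z - x k) \<bullet> (?y - ?z)"
    have l: "0 < ?l" using lam_range by blast
    have "G (Suc k) + (\<phi> (Suc k) ?y - \<phi> (Suc k) ?z) / ?l \<le> G k"
      using step[of "Suc k" ?z] by (simp add: G)
    moreover have "\<phi> (Suc k) ?y - \<phi> (Suc k) ?z
        = ?l * (grad f ?z \<bullet> (?y - ?z)) - ?\<beta> * ?I + D ?y ?z"
      by (simp add: \<phi>_def w_def D_def inner_commute algebra_simps)
    ultimately have "G (Suc k) + grad f ?z \<bullet> (?y - ?z) + 1 / ?l * D ?y ?z \<le> G k + ?\<beta> / ?l * ?I"
      using l by (simp add: add_divide_distrib diff_divide_distrib)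
    moreover have "?\<beta> / ?l * ?I \<le> b / 2 * ((d k)\<^sup>2 + (d (Suc k))\<^sup>2)"
    proof -
      \<comment> \<open>Young's inequality for the inertial term, from the square of a
        difference.\<close>
      have "0 \<le> (norm ((?z - x k) - (?y - ?z)))\<^sup>2" by simp
      then have "?I \<le> ((d k)\<^sup>2 + (d (Suc k))\<^sup>2) / 2"
        unfolding d_def power2_norm_eq_inner by (simp add: inner_diff_left inner_diff_right inner_commute)
      then have "?\<beta> / ?l * ?I \<le> ?\<beta> / ?l * (((d k)\<^sup>2 + (d (Suc k))\<^sup>2) / 2)"
        using l beta_range[of "Suc k"] by (intro mult_left_mono) auto
      also have "\<dots> \<le> b * (((d k)\<^sup>2 + (d (Suc k))\<^sup>2) / 2)"
        by (intro mult_right_mono beta_lam) auto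
      finally show ?thesis by simp
    qed
    moreover have "1 / ls * D ?y ?z \<le> 1 / ?l * D ?y ?z"
      by (intro mult_right_mono inv_lam D_nonneg)
    ultimately show ?thesis
      using descent_lemma[of ?y ?z] unfolding P_def c_def left_diff_distrib by linarith
  qed
  have strong: "\<sigma> / 2 * (d (Suc k))\<^sup>2 \<le> D (x (Suc (Suc k))) (x (Suc k))" for k
    unfolding d_def by (rule D_strong)
  note conv = inertial_descent_converges[of P c "\<lambda>k. D (x (Suc (Suc k))) (x (Suc k))" b d,
      OF descent strong m sigma b]
  obtain \<zeta> where P_lim: "P \<longlonglongrightarrow> \<zeta>" using conv(3) by (auto simp: convergent_def)
  have Psi_lim: "(\<lambda>k. \<Psi> (x k)) \<longlonglongrightarrow> ereal \<zeta>"
    by (rule LIMSEQ_imp_Suc) (simp add: Psi_P P_lim)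
  \<comment> \<open>The descent covers all terms but the first, which is a real number.\<close>
  have "summable (\<lambda>k. D (x (Suc k)) (x k))"
    using conv(1) by (subst summable_Suc_iff[symmetric])
  then have sum_finite: "(\<Sum>k. bregman h (x (Suc k)) (x k)) < \<infinity>"
    unfolding breg by (auto simp: summable_def sums_ereal[symmetric] dest: sums_unique[symmetric])
  have norm_lim: "(\<lambda>k. norm (x k - x (k - 1))) \<longlonglongrightarrow> 0"
    by (rule LIMSEQ_imp_Suc) (use conv(2) in \<open>simp add: d_def[abs_def]\<close>)
  then have diff_lim: "(\<lambda>k. x k - x (k - 1)) \<longlonglongrightarrow> 0"
    by (rule tendsto_norm_zero_cancel)

  \<comment> \<open>Cluster points\<close>
  have cluster: "critical_point \<Psi> u \<and> \<Psi> u = ereal \<zeta>" if u: "u \<in> cluster_points x" for u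
  proof -
    obtain r where r: "strict_mono r" "(x \<circ> r) \<longlonglongrightarrow> u"
      using u by (auto simp: cluster_points_def)
    \<comment> \<open>Since \<open>r (Suc n) > 0\<close>, the subsequence consists of solutions
      \<open>x (Suc (q n))\<close> of the subproblems with index \<open>q n\<close>; dropping
      \<open>r 0\<close> keeps the truncated subtraction exact.\<close>
    define q where "q n = r (Suc n) - 1" for n
    have Suc_q: "Suc (q n) = r (Suc n)" for n
      using strict_mono_less[OF r(1), of 0 "Suc n"] by (simp add: q_def)
    have "strict_mono q"
      by (metis Suc_q Suc_less_SucD r(1) strict_mono_Suc_iff)
    then have q: "filterlim q sequentially sequentially"
      by (rule filterlim_subseq)
    have Y: "(\<lambda>n. x (Suc (q n))) \<longlonglongrightarrow> u"
      unfolding Suc_q using LIMSEQ_Suc[OF r(2)] by (simp add: o_def)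
    have "(\<lambda>n. x (Suc (q n)) - x (Suc (q n) - 1)) \<longlonglongrightarrow> 0"
      by (rule filterlim_compose[OF filterlim_compose[OF diff_lim filterlim_Suc] q])
    from tendsto_diff[OF Y this] have X: "(\<lambda>n. x (q n)) \<longlonglongrightarrow> u" by simp
    have \<delta>: "(\<lambda>n. x (q n) - x (q n - 1)) \<longlonglongrightarrow> 0"
      by (rule filterlim_compose[OF diff_lim q])
    have continuous_lim: "(\<lambda>n. k (z n)) \<longlonglongrightarrow> k u"
      if "continuous_on UNIV k" "z \<longlonglongrightarrow> u" for k :: "'a \<Rightarrow> 'b::real_normed_vector" and z
      using that continuous_on_tendsto_compose[of UNIV k z u sequentially] by simp
    note lims = X Y continuous_lim[OF cont_f' X] continuous_lim[OF cont_f' Y]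
      continuous_lim[OF cont_h' X] continuous_lim[OF cont_h' Y]
      continuous_lim[OF cont_F Y] continuous_lim[OF cont_H X] continuous_lim[OF cont_H Y]
    have bounds: "\<bar>1 / lam (q n)\<bar> \<le> 1 / li" "\<bar>\<beta> (q n) / lam (q n)\<bar> \<le> b" for n
      using inv_lam[of "q n"] beta_lam[of "q n"] lam_range[of "q n"] beta_range[of "q n"] by auto
    have D_YX: "(\<lambda>n. D (x (Suc (q n))) (x (q n))) \<longlonglongrightarrow> H u - H u - grad h u \<bullet> (u - u)"
      and D_uX: "(\<lambda>n. D u (x (q n))) \<longlonglongrightarrow> H u - H u - grad h u \<bullet> (u - u)"
      unfolding D_def by (intro tendsto_intros lims)+

    \<comment> \<open>With this \<open>e\<close>, \<open>step\<close> at the cluster point reads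
      \<open>G (q n) + e n \<le> g u\<close>. The expansion \<open>e_eq\<close> exhibits null
      sequences with bounded factors.\<close>
    define e where "e n = (\<phi> (q n) (x (Suc (q n))) - \<phi> (q n) u) / lam (q n)" for n
    have e_eq: "e n = (x (Suc (q n)) - u) \<bullet> grad f (x (q n))
        - (\<beta> (q n) / lam (q n)) *\<^sub>R ((x (Suc (q n)) - u) \<bullet> (x (q n) - x (q n - 1)))
        + (1 / lam (q n)) *\<^sub>R (D (x (Suc (q n))) (x (q n)) - D u (x (q n)))" for n
      using lam_range[of "q n"]
      by (simp add: e_def \<phi>_def w_def inner_diff_left inner_diff_right inner_add_right field_simps)
    have "e \<longlonglongrightarrow> (u - u) \<bullet> grad f u - 0 + 0"
      unfolding e_eq[abs_def]
    proof (intro tendsto_add tendsto_diff tendsto_inner lims tendsto_const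
        bounded_scaleR_tendsto_zero[OF _ bounds(1)] bounded_scaleR_tendsto_zero[OF _ bounds(2)])
      show "(\<lambda>n. (x (Suc (q n)) - u) \<bullet> (x (q n) - x (q n - 1))) \<longlonglongrightarrow> 0"
        using tendsto_inner[OF tendsto_diff[OF Y tendsto_const[of u]] \<delta>] by simp
      show "(\<lambda>n. D (x (Suc (q n))) (x (q n)) - D u (x (q n))) \<longlonglongrightarrow> 0"
        using tendsto_diff[OF D_YX D_uX] by simp
    qed
    then have e: "e \<longlonglongrightarrow> 0" by simp
    \<comment> \<open>The limit of \<open>G (q n)\<close> is already forced by convergence of
      \<open>P\<close> and continuity of \<open>F\<close>; it remains to identify it with
      \<open>g u\<close>.\<close>
    have "(\<lambda>n. P (q n) - F (x (Suc (q n)))) \<longlonglongrightarrow> \<zeta> - F u"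
      by (intro tendsto_diff filterlim_compose[OF P_lim q] lims)
    then have G_lim: "(\<lambda>n. G (q n)) \<longlonglongrightarrow> \<zeta> - F u" by (simp add: P_def)
    have "g u \<le> ereal (\<zeta> - F u)"
      by (rule lsc_fun_le_lim[OF g_lsc Y, of "\<lambda>n. ereal (G (q n))"]) (simp_all add: G G_lim)
    moreover have "ereal (\<zeta> - F u) \<le> g u"
    proof (rule LIMSEQ_le_const2)
      show "(\<lambda>n. ereal (G (q n) + e n)) \<longlonglongrightarrow> ereal (\<zeta> - F u)"
        using tendsto_add[OF G_lim e] by simp
      show "\<exists>N. \<forall>n\<ge>N. ereal (G (q n) + e n) \<le> g u"
        unfolding e_def using step by blast
    qed
    ultimately have "g u = ereal (\<zeta> - F u)" by (rule antisym)
    then have Psi_u: "\<Psi> u = ereal \<zeta>" by (simp add: Psi) (simp add: f)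

    \<comment> \<open>The gradient at \<open>x (Suc k)\<close> of the minorant
      \<open>?\<theta>\<close> of \<Psi> below, which is \<open>F\<close> plus the minorant of
      \<open>g\<close> from \<open>step\<close>.\<close>
    define v where "v k = grad f (x (Suc k))
        - (1 / lam k) *\<^sub>R (w k + grad h (x (Suc k)) - grad h (x k))" for k
    have v: "v k \<in> frechet_subdiff \<Psi> (x (Suc k))" for k
    proof -
      let ?\<theta> = "\<lambda>z. F z + (G k + (\<phi> k (x (Suc k)) - \<phi> k z) / lam k)"
      have minor: "ereal (?\<theta> z) \<le> \<Psi> z" for z
        using add_left_mono[OF step[of k z], of "ereal (F z)"] by (simp add: Psi) (simp add: f)
      have at: "\<Psi> (x (Suc k)) = ereal (?\<theta> (x (Suc k)))" by (simp add: Psi_P P_def)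
      have "GDERIV ?\<theta> (x (Suc k)) :> v k"
        using F'[of "x (Suc k)"] H'[of "x (Suc k)"] lam_range[of k]
        unfolding gderiv_def \<phi>_def D_def v_def
        by (auto intro!: derivative_eq_intros
            simp: inner_diff_right inner_add_right inner_commute field_simps)
      with at minor show ?thesis by (rule frechet_subdiffI)
    qed
    \<comment> \<open>Inserting \<open>w\<close> pairs the gradients at consecutive iterates, so
      continuity and vanishing steps send every term to 0.\<close>
    have v_eq: "v (q n) = grad f (x (Suc (q n))) - grad f (x (q n))
        + (\<beta> (q n) / lam (q n)) *\<^sub>R (x (q n) - x (q n - 1))
        - (1 / lam (q n)) *\<^sub>R (grad h (x (Suc (q n))) - grad h (x (q n)))" for n
      using lam_range[of "q n"] by (simp add: v_def w_def algebra_simps)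
    have "(\<lambda>n. v (q n)) \<longlonglongrightarrow> grad f u - grad f u + 0 - 0"
      unfolding v_eq
    proof (intro tendsto_add tendsto_diff lims \<delta>
        bounded_scaleR_tendsto_zero[OF _ bounds(1)] bounded_scaleR_tendsto_zero[OF _ bounds(2)])
      show "(\<lambda>n. grad h (x (Suc (q n))) - grad h (x (q n))) \<longlonglongrightarrow> 0"
        using tendsto_diff[OF lims(6,5)] by simp
    qed
    then have "(\<lambda>n. v (q n)) \<longlonglongrightarrow> 0" by simp
    moreover have "(\<lambda>n. \<Psi> (x (Suc (q n)))) \<longlonglongrightarrow> \<Psi> u"
      unfolding Psi_P Psi_u using filterlim_compose[OF P_lim q] by simp
    ultimately have "\<exists>xs vs. xs \<longlonglongrightarrow> u \<and> (\<lambda>n. \<Psi> (xs n)) \<longlonglongrightarrow> \<Psi> u \<and>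
        (\<forall>n. vs n \<in> frechet_subdiff \<Psi> (xs n)) \<and> vs \<longlonglongrightarrow> 0"
      using Y v by meson
    then have "critical_point \<Psi> u"
      by (simp add: critical_point_def limiting_subdiff_def dom_fun_def Psi_u)
    with Psi_u show ?thesis by blast
  qed
  show ?thesis
    using sum_finite norm_lim Psi_lim cluster by blast
qed

end
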